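(* For any integer $m\geq 1$, there are infinitely many virtual knots $K$ with ${\rm u}_{v\Delta}(K)=m$.
   Context: A virtual link diagram is a generic immersion of finitely many oriented circles in the plane in which each double point is either a real crossing (with over/under information) or a virtual crossing. Virtual links are equivalence classes of such diagrams under generalized Reidemeister moves (the classical Reidemeister moves I, II, III together with the virtual moves involving virtual crossings); equivalently, they are equivalence classes of Gauss diagrams under the Reidemeister moves I, II, III on Gauss diagrams. In a Gauss diagram, each real crossing is recorded as a signed chord oriented from the over-crossing point (initial endpoint) to the under-crossing point (terminal endpoint). A virtual knot is a one-component virtual link. A virtualized $\Delta$-move ($v\Delta$) is the following local deformation of a virtual link diagram, performed in either direction. In a disk, three strands (with arbitrary orientations, belonging to arbitrary components) pairwise cross exactly once, forming a triangle, and all three crossings are real and alternating, i.e. each strand passes over one of the other two strands and under the other one; the move replaces the three real crossings by three virtual crossings. Both alternating patterns (mirror images of each other) are allowed. In terms of Gauss diagrams, the move deletes or inserts three chords of the following form: there are three disjoint arcs $s_1,s_2,s_3$ of the underlying circles, the three chords run from $s_1$ to $s_2$, from $s_2$ to $s_3$ and from $s_3$ to $s_1$, and the $s_i$ contain no other chord endpoints; setting $\eta_i=+1$ if along the oriented arc $s_i$ the terminal endpoint precedes the initial endpoint and $\eta_i=-1$ otherwise, the sign of the chord joining $s_i$ and $s_j$ is $\delta\eta_i\eta_j$ with a common $\delta\in\{+1,-1\}$ for all three chords (the two values of $\delta$ correspond to the two alternating patterns). Every virtual knot can be deformed into the trivial knot by a finite sequence of virtualized $\Delta$-moves and generalized Reidemeister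 moves. The $v\Delta$-unknotting number ${\rm u}_{v\Delta}(K)$ is the minimal number of virtualized $\Delta$-moves needed in such a sequence deforming a diagram of $K$ into a diagram of the trivial knot (generalized Reidemeister moves are not counted). *)

theory Defs
  imports Main "HOL-Library.Multiset" "HOL-Library.Extended_Nat"
begin

text \<open>
  Virtual knots are treated as equivalence classes of Gauss diagrams on one oriented circle.  (All
  moves below preserve the number of circles, so no other diagrams arise when a knot is deformed.)
  A Gauss diagram is written as the list of its chord endpoints in the order in which they are met
  along the circle from a base point; chords are named by natural numbers and each endpoint carries
  the sign of its chord.  A chord \<open>c\<close> points from \<open>Over c e\<close> (initial) to \<open>Under c e\<close> (terminal).
\<close>

datatype 'c endpoint = Over 'c int | Under 'c int

type_synonym gauss_word = "nat endpoint list"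

definition gauss_diagram :: "gauss_word \<Rightarrow> bool" where
  "gauss_diagram w \<longleftrightarrow>
     distinct w \<and>
     (\<forall>c e. Over c e \<in> set w \<longleftrightarrow> Under c e \<in> set w) \<and>
     (\<forall>c e e'. Over c e \<in> set w \<and> Over c e' \<in> set w \<longrightarrow> e = e') \<and>
     (\<forall>c e. Over c e \<in> set w \<longrightarrow> e \<in> {1, -1})"

text \<open>
  An arc containing exactly the endpoints \<open>x\<close> and \<open>y\<close>, met in this order iff \<open>\<eta> = 1\<close>.
\<close>

definition strand :: "int \<Rightarrow> 'a \<Rightarrow> 'a \<Rightarrow> 'a list" where
  "strand \<eta> x y = (if \<eta> = 1 then [x, y] else [y, x])"

text \<open>
  The first two rules only account for the choice of base point and of chord names; since they are
  available, the moves may assume that the word starts at one of the arcs involved.  That the names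
  of created chords are fresh is enforced below, where both sides are required to be Gauss diagrams.

  In the third move, chord \<open>a\<close> runs from the top strand \<open>sT\<close> to the middle strand \<open>sM\<close>, chord
  \<open>b\<close> from \<open>sM\<close> to the bottom strand \<open>sB\<close>, and chord \<open>c\<close> from \<open>sT\<close> to \<open>sB\<close>.  If the edges of the
  triangle on \<open>sT\<close>, \<open>sM\<close>, \<open>sB\<close> follow each other counterclockwise in this order and each \<open>\<eta>\<close> tells
  whether the strand is oriented counterclockwise, then along a strand with \<open>\<eta> = 1\<close> the endpoints
  are met in the order given here, and the signs of \<open>a\<close>, \<open>b\<close>, \<open>c\<close> are \<open>\<eta>T * \<eta>M\<close>, \<open>\<eta>M * \<eta>B\<close>,
  \<open>- \<eta>T * \<eta>B\<close>.  For the other cyclic order, all three \<open>\<eta>\<close> and all three signs are negated; this is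
  \<open>\<delta> = -1\<close>.  The multiset equation lets the three arcs occur in any order along the circle.
\<close>

inductive reidemeister_move :: "gauss_word \<Rightarrow> gauss_word \<Rightarrow> bool" where
  base_point: "reidemeister_move (X @ Y) (Y @ X)"
| relabel: "inj f \<Longrightarrow> reidemeister_move w (map (map_endpoint f) w)"
| R1: "reidemeister_move (strand \<eta> (Over c e) (Under c e) @ X) X"
| R2: "reidemeister_move
        ([Over a e, Over b (-e)] @ X @ strand \<eta> (Under a e) (Under b (-e)) @ Y) (X @ Y)"
| R3: "\<lbrakk> {\<delta>, \<eta>T, \<eta>M, \<eta>B} \<subseteq> {1, -1};
         ea = \<delta> * \<eta>T * \<eta>M; eb = \<delta> * \<eta>M * \<eta>B; ec = - \<delta> * \<eta>T * \<eta>B;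
         sT = strand \<eta>T (Over c ec) (Over a ea);
         sM = strand \<eta>M (Under a ea) (Over b eb);
         sB = strand \<eta>B (Under b eb) (Under c ec);
         {# P, Q, R #} = {# sT, sM, sB #} \<rbrakk>
       \<Longrightarrow> reidemeister_move (P @ X @ Q @ Y @ R @ Z) (rev P @ X @ rev Q @ Y @ rev R @ Z)"

definition reidemeister_step :: "gauss_word \<Rightarrow> gauss_word \<Rightarrow> bool" where
  "reidemeister_step v w \<longleftrightarrow>
     gauss_diagram v \<and> gauss_diagram w \<and> (reidemeister_move v w \<or> reidemeister_move w v)"

definition diagram_equiv :: "(gauss_word \<times> gauss_word) set" where
  "diagram_equiv = {(v, w). gauss_diagram v \<and> gauss_diagram w \<and> reidemeister_step\<^sup>*\<^sup>* v w}"

definition virtual_knots :: "gauss_word set set" where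
  "virtual_knots = {w. gauss_diagram w} // diagram_equiv"

definition trivial_knot :: "gauss_word set" where
  "trivial_knot = diagram_equiv `` {[]}"

text \<open>
  Deletion of three chords \<open>c1\<close>, \<open>c2\<close>, \<open>c3\<close> running from \<open>s1\<close> to \<open>s2\<close>, from \<open>s2\<close> to \<open>s3\<close> and from
  \<open>s3\<close> to \<open>s1\<close>.
\<close>

inductive vdelta_move :: "gauss_word \<Rightarrow> gauss_word \<Rightarrow> bool" where
  "\<lbrakk> {\<delta>, \<eta>1, \<eta>2, \<eta>3} \<subseteq> {1, -1};
     e1 = \<delta> * \<eta>1 * \<eta>2; e2 = \<delta> * \<eta>2 * \<eta>3; e3 = \<delta> * \<eta>3 * \<eta>1;
     s1 = strand \<eta>1 (Under c3 e3) (Over c1 e1);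
     s2 = strand \<eta>2 (Under c1 e1) (Over c2 e2);
     s3 = strand \<eta>3 (Under c2 e2) (Over c3 e3);
     {# P, Q, R #} = {# s1, s2, s3 #} \<rbrakk>
   \<Longrightarrow> vdelta_move (P @ X @ Q @ Y @ R @ Z) (X @ Y @ Z)"

definition vdelta_step :: "gauss_word \<Rightarrow> gauss_word \<Rightarrow> bool" where
  "vdelta_step v w \<longleftrightarrow>
     gauss_diagram v \<and> gauss_diagram w \<and> (vdelta_move v w \<or> vdelta_move w v)"

text \<open>
  \<open>vdelta_sequence n v w\<close>: some finite sequence of moves leads from \<open>v\<close> to \<open>w\<close>, exactly \<open>n\<close> of
  which are virtualized Delta-moves.
\<close>

inductive vdelta_sequence :: "nat \<Rightarrow> gauss_word \<Rightarrow> gauss_word \<Rightarrow> bool" where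
  start: "gauss_diagram w \<Longrightarrow> vdelta_sequence 0 w w"
| reidemeister: "vdelta_sequence n u v \<Longrightarrow> reidemeister_step v w \<Longrightarrow> vdelta_sequence n u w"
| vdelta: "vdelta_sequence n u v \<Longrightarrow> vdelta_step v w \<Longrightarrow> vdelta_sequence (Suc n) u w"

definition vdelta_unknotting_number :: "gauss_word set \<Rightarrow> enat" where
  "vdelta_unknotting_number K =
     Inf {enat n | n. \<exists>v \<in> K. \<exists>w \<in> trivial_knot. vdelta_sequence n v w}"

lemma equiv_diagram_equiv: "equiv {w. gauss_diagram w} diagram_equiv"
proof -
  have "symp reidemeister_step"
    by (auto simp: symp_def reidemeister_step_def)
  then have "symp reidemeister_step\<^sup>*\<^sup>*"
    by (rule symp_rtranclp)
  then show ?thesis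
    by (auto simp: diagram_equiv_def equiv_def refl_on_def sym_def symp_def trans_def
        intro: rtranclp_trans)
qed

end

theory Submission
  imports Defs
begin

text \<open>
  Give the initial endpoint of a chord with sign \<open>e\<close> the weight \<open>e\<close> and the terminal one the weight
  \<open>-e\<close>.  The \<^emph>\<open>index\<close> of a chord is the total weight met strictly between its initial and its
  terminal endpoint, and for any function \<open>g\<close> with \<open>g 0 = 0\<close> the sum of \<open>e * g (index)\<close> over all
  chords is a knot invariant: the chord of a first Reidemeister move has index 0, the two chords of a
  second move have opposite signs and equal indices, and a third move changes no index
  (\<open>writhe_reidemeister_move\<close>).  Two choices of \<open>g\<close> are needed.

  The first is the parity of the index, which gives the odd writhe.  Each of the three arcs of a
  virtualized Delta-move carries an even weight, so the move preserves the parities of all other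
  indices.  The indices of the three chords of the move have an even sum, so at most two of these
  chords count, and the odd writhe changes by at most 2
  (\<open>odd_writhe_vdelta_move\<close>).  As the odd writhe of the trivial knot is 0,
  a knot with odd writhe \<open>2 * m\<close> has unknotting number at least \<open>m\<close>.

  For the upper bound, start with the three chords of a virtualized Delta-move with signs \<open>1, -1, 1\<close>,
  and let \<open>n\<close> nested positive chords run from the gap between the first two arcs to the gap between
  the last two.  One virtualized Delta-move deletes the three chords, and the nested chords then
  disappear by first Reidemeister moves.  For even \<open>n\<close> this diagram has odd writhe 2.  Hence \<open>m\<close>
  copies placed one after the other have odd writhe \<open>2 * m\<close> and are unknotted by \<open>m\<close> moves
  (\<open>vdelta_sequence_triangle_sum\<close>).

  The second choice, \<open>g n = n\<^sup>2\<close>, separates these knots: it takes the value \<open>m * (2 * n + 2)\<close> on them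
  (\<open>writhe_triangle_diagram\<close>), so different even \<open>n\<close> give different knots.
\<close>

section \<open>Indices and writhes\<close>

fun weight :: "'c endpoint \<Rightarrow> int" where
  "weight (Over c e) = e"
| "weight (Under c e) = - e"

abbreviation total_weight :: "'c endpoint list \<Rightarrow> int" where
  "total_weight w \<equiv> sum_list (map weight w)"

text \<open>
  Since a Gauss diagram has total weight 0, the weight of the cyclic arc from \<open>Over c e\<close> to
  \<open>Under c e\<close> is a difference of heights, whichever of the two endpoints comes first in the word.
  The term \<open>- e\<close> in the index removes the contribution of \<open>Over c e\<close> itself.
\<close>

definition height :: "'c endpoint list \<Rightarrow> 'c endpoint \<Rightarrow> int" where
  "height w x = total_weight (takeWhile (\<lambda>y. y \<noteq> x) w)"

definition index :: "'c endpoint list \<Rightarrow> 'c \<Rightarrow> int \<Rightarrow> int" where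
  "index w c e = height w (Under c e) - height w (Over c e) - e"

definition chords :: "'c endpoint list \<Rightarrow> ('c \<times> int) set" where
  "chords w = {(c, e). Over c e \<in> set w}"

text \<open>
  If \<open>J n\<close> is the sum of the signs of the chords of index \<open>n\<close> (the \<open>n\<close>-writhe), this is the sum of
  \<open>g n * J n\<close> over all \<open>n\<close>.
\<close>

definition writhe :: "(int \<Rightarrow> int) \<Rightarrow> 'c endpoint list \<Rightarrow> int" where
  "writhe g w = (\<Sum>(c, e)\<in>chords w. e * g (index w c e))"

lemma height_Nil [simp]: "height [] x = 0"
  by (simp add: height_def)

lemma height_Cons [simp]: "height (y # w) x = (if y = x then 0 else weight y + height w x)"
  by (simp add: height_def)

lemma height_append:
  "height (v @ w) x = (if x \<in> set v then height v x else total_weight v + height w x)"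
  by (induction v) auto

lemma height_adjacent:
  assumes "distinct (v @ [x, y] @ w)"
  shows "height (v @ [x, y] @ w) y = height (v @ [x, y] @ w) x + weight x"
  using assms by (auto simp: height_append)

lemma finite_chords [simp]: "finite (chords w)"
proof -
  have "finite ((\<lambda>(c, e). Over c e) -` set w \<inter> UNIV)"
    by (rule finite_vimage_IntI) (auto simp: inj_on_def)
  moreover have "chords w = (\<lambda>(c, e). Over c e) -` set w \<inter> UNIV"
    by (auto simp: chords_def)
  ultimately show ?thesis by simp
qed

lemma chords_append [simp]: "chords (v @ w) = chords v \<union> chords w"
  by (auto simp: chords_def)

lemma chord_endpoints:
  assumes "gauss_diagram w" "(c, e) \<in> chords w"
  shows "Over c e \<in> set w" "Under c e \<in> set w"
  using assms by (auto simp: gauss_diagram_def chords_def)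

lemma gauss_diagram_distinct: "gauss_diagram w \<Longrightarrow> distinct w"
  by (simp add: gauss_diagram_def)

lemma total_weight_gauss_diagram:
  assumes "gauss_diagram w"
  shows "total_weight w = 0"
proof -
  let ?O = "(\<lambda>(c, e). Over c e) ` chords w" and ?U = "(\<lambda>(c, e). Under c e) ` chords w"
  have "x \<in> set w \<longleftrightarrow> x \<in> ?O \<union> ?U" for x
    using assms by (cases x) (auto simp: gauss_diagram_def chords_def image_iff)
  then have "set w = ?O \<union> ?U" by blast
  then have "total_weight w = sum weight (?O \<union> ?U)"
    using assms by (simp add: gauss_diagram_def sum_list_distinct_conv_sum_set)
  also have "\<dots> = sum weight ?O + sum weight ?U"
    by (rule sum.union_disjoint) auto
  also have "\<dots> = (\<Sum>(c, e)\<in>chords w. e) + (\<Sum>(c, e)\<in>chords w. - e)"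
    by (subst (1 2) sum.reindex) (auto simp: inj_on_def intro!: arg_cong2[where f = "(+)"] sum.cong)
  also have "\<dots> = 0"
    by (simp add: case_prod_unfold sum_negf)
  finally show ?thesis .
qed

lemma writhe_cong:
  assumes "chords v = chords w"
    and "\<And>c e. (c, e) \<in> chords w \<Longrightarrow> index v c e = index w c e"
  shows "writhe g v = writhe g w"
  unfolding writhe_def using assms by (auto intro!: sum.cong)

text \<open>
  The common pattern of all moves that delete chords.  The values of \<open>g\<close> are compared rather than the
  indices because a virtualized Delta-move preserves indices only modulo 2.
\<close>

lemma writhe_remove_chords:
  assumes "chords v = D \<union> chords w" "D \<inter> chords w = {}"
    and "\<And>c e. (c, e) \<in> chords w \<Longrightarrow> g (index v c e) = g (index w c e)"
  shows "writhe g v = (\<Sum>(c, e)\<in>D. e * g (index v c e)) + writhe g w"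
proof -
  have "finite D"
    using assms(1) finite_chords[of v] by auto
  then have "writhe g v =
      (\<Sum>(c, e)\<in>D. e * g (index v c e)) + (\<Sum>(c, e)\<in>chords w. e * g (index v c e))"
    unfolding writhe_def assms(1) using assms(2) by (intro sum.union_disjoint) auto
  also have "(\<Sum>(c, e)\<in>chords w. e * g (index v c e)) = writhe g w"
    unfolding writhe_def using assms(3) by (auto intro!: sum.cong)
  finally show ?thesis .
qed

lemma index_eqI:
  assumes "gauss_diagram w" "\<And>x. x \<in> set w \<Longrightarrow> height v x = height w x" "(c, e) \<in> chords w"
  shows "index v c e = index w c e"
  using assms chord_endpoints[OF assms(1,3)] by (simp add: index_def)

section \<open>Invariance under the Reidemeister moves\<close>

text \<open>
  Rotating the word shifts all heights by the same amount: endpoints of \<open>X\<close> go up by the weight of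
  \<open>Y\<close>, endpoints of \<open>Y\<close> go down by the weight of \<open>X\<close>, and these two weights add up to 0.
\<close>

lemma writhe_base_point:
  assumes "gauss_diagram (X @ Y)"
  shows "writhe g (X @ Y) = writhe g (Y @ X)"
proof (rule writhe_cong)
  fix c e assume "(c, e) \<in> chords (Y @ X)"
  then have "(c, e) \<in> chords (X @ Y)" by auto
  note ends = chord_endpoints[OF assms this]
  have "height (Y @ X) x = height (X @ Y) x + total_weight Y" if "x \<in> set (X @ Y)" for x
    using that gauss_diagram_distinct[OF assms] total_weight_gauss_diagram[OF assms]
    by (auto simp: height_append)
  then show "index (X @ Y) c e = index (Y @ X) c e"
    using ends by (simp add: index_def)
qed auto

lemma weight_map_endpoint [simp]: "weight (map_endpoint f x) = weight x"
  by (cases x) auto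

lemma height_relabel:
  assumes "inj f"
  shows "height (map (map_endpoint f) w) (map_endpoint f x) = height w x"
proof -
  have "map_endpoint f y = map_endpoint f x \<longleftrightarrow> y = x" for y
    using endpoint.inj_map[OF assms] by (auto dest: injD)
  then show ?thesis by (induction w) auto
qed

lemma Over_relabel_iff:
  "Over c e \<in> map_endpoint f ` A \<longleftrightarrow> (\<exists>b. c = f b \<and> Over b e \<in> A)"
proof
  assume "Over c e \<in> map_endpoint f ` A"
  then obtain x where "x \<in> A" "map_endpoint f x = Over c e" by auto
  then show "\<exists>b. c = f b \<and> Over b e \<in> A" by (cases x) auto
qed force

lemma Under_relabel_iff:
  "Under c e \<in> map_endpoint f ` A \<longleftrightarrow> (\<exists>b. c = f b \<and> Under b e \<in> A)"
proof
  assume "Under c e \<in> map_endpoint f ` A"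
  then obtain x where "x \<in> A" "map_endpoint f x = Under c e" by auto
  then show "\<exists>b. c = f b \<and> Under b e \<in> A" by (cases x) auto
qed force

lemma chords_relabel: "chords (map (map_endpoint f) w) = map_prod f id ` chords w"
proof -
  have "(c, e) \<in> map_prod f id ` chords w \<longleftrightarrow> (\<exists>b. c = f b \<and> Over b e \<in> set w)" for c e
    by (auto simp: chords_def map_prod_def image_iff)
  then show ?thesis
    by (auto simp: chords_def Over_relabel_iff)
qed

lemma writhe_relabel:
  assumes "inj f"
  shows "writhe g (map (map_endpoint f) w) = writhe g w"
proof -
  have "index (map (map_endpoint f) w) (f c) e = index w c e" for c e
    using height_relabel[OF assms, of w "Over c e"] height_relabel[OF assms, of w "Under c e"]
    by (simp add: index_def)
  moreover have "inj_on (map_prod f id) (chords w)"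
    using assms by (intro inj_on_subset[OF prod.inj_map]) auto
  ultimately show ?thesis
    unfolding writhe_def chords_relabel
    by (subst sum.reindex) (auto intro!: sum.cong)
qed

text \<open>
  Nothing lies between the two endpoints of the chord, so its index is 0; its two weights cancel, so
  no other height changes.
\<close>

lemma writhe_R1:
  assumes "g 0 = 0" "gauss_diagram (strand \<eta> (Over c e) (Under c e) @ X)" "gauss_diagram X"
  shows "writhe g (strand \<eta> (Over c e) (Under c e) @ X) = writhe g X" (is "writhe g ?v = _")
proof -
  have dist: "distinct ?v" using assms(2) by (rule gauss_diagram_distinct)
  have "writhe g ?v = (\<Sum>(c, e)\<in>{(c, e)}. e * g (index ?v c e)) + writhe g X"
  proof (rule writhe_remove_chords)
    fix c' e' assume "(c', e') \<in> chords X"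
    then show "g (index ?v c' e') = g (index X c' e')"
      using dist by (subst index_eqI[OF assms(3), of ?v])
        (auto simp: strand_def split: if_splits)
  qed (use dist in \<open>auto simp: chords_def strand_def split: if_splits\<close>)
  moreover have "index ?v c e = 0"
    by (simp add: index_def strand_def)
  ultimately show ?thesis using assms(1) by simp
qed

text \<open>
  Both arcs of the move have weight 0, so the other heights do not change.  The two chords have equal
  indices because the part of the circle between their endpoints differs only by endpoints of the two
  chords themselves, and since their signs are opposite, their contributions cancel.
\<close>

lemma writhe_R2:
  fixes a b :: nat and X Y :: gauss_word
  assumes "gauss_diagram ([Over a e, Over b (-e)] @ X @ strand \<eta> (Under a e) (Under b (-e)) @ Y)"
    and "gauss_diagram (X @ Y)"
  shows "writhe g ([Over a e, Over b (-e)] @ X @ strand \<eta> (Under a e) (Under b (-e)) @ Y)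
    = writhe g (X @ Y)" (is "writhe g ?v = _")
proof -
  have dist: "distinct ?v" using assms(1) by (rule gauss_diagram_distinct)
  then have ab: "(a, e) \<noteq> (b, -e)" by auto
  have "writhe g ?v = (\<Sum>(c, e)\<in>{(a, e), (b, -e)}. e * g (index ?v c e)) + writhe g (X @ Y)"
  proof (rule writhe_remove_chords)
    fix c' e' assume "(c', e') \<in> chords (X @ Y)"
    then show "g (index ?v c' e') = g (index (X @ Y) c' e')"
      using dist by (subst index_eqI[OF assms(2), of ?v])
        (auto simp: strand_def height_append split: if_splits)
  qed (use dist in \<open>auto simp: chords_def strand_def split: if_splits\<close>)
  moreover have "index ?v a e = index ?v b (-e)"
    using dist by (auto simp: index_def strand_def height_append)
  moreover have "(\<Sum>(c, e)\<in>{(a, e), (b, -e)}. e * g (index ?v c e)) =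
      e * g (index ?v a e) - e * g (index ?v b (-e))"
    using ab by simp
  ultimately show ?thesis by simp
qed

text \<open>
  The arcs of a move occur along the circle in any of six orders; these two consequences of the
  multiset equation are all that matters about the order.
\<close>

lemma three_arcs:
  assumes "{# P, Q, R #} = {# s1, s2, s3 #}"
  shows "{P, Q, R} = {s1, s2, s3}" "mset (P @ Q @ R) = mset (s1 @ s2 @ s3)"
proof -
  show "{P, Q, R} = {s1, s2, s3}"
    using arg_cong[OF assms, of set_mset] by simp
  show "mset (P @ Q @ R) = mset (s1 @ s2 @ s3)"
    using arg_cong[OF assms, of "\<lambda>M. \<Sum>\<^sub># (image_mset mset M)"] by simp
qed

text \<open>
  Reversing an arc preserves its weight, hence the height at which any other arc starts.
\<close>

lemma height_reverse_arcs:
  assumes "distinct (P @ X @ Q @ Y @ R @ Z)"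
    and "S \<in> {P, Q, R}" "x \<in> set S"
  shows "height (rev P @ X @ rev Q @ Y @ rev R @ Z) x - height (P @ X @ Q @ Y @ R @ Z) x
    = height (rev S) x - height S x"
  using assms by (auto simp: height_append sum_list_rev rev_map[symmetric])

lemma height_reverse_arcs_outside:
  assumes "x \<notin> set P \<union> set Q \<union> set R"
  shows "height (rev P @ X @ rev Q @ Y @ rev R @ Z) x = height (P @ X @ Q @ Y @ R @ Z) x"
  using assms by (auto simp: height_append sum_list_rev rev_map[symmetric])

text \<open>
  On each strand, an endpoint moves up or down by the weight of the other endpoint on that strand.
  The choice of the three signs is exactly what makes both endpoints of a chord move by the same
  amount; for the chord \<open>a\<close> this amount is \<open>\<delta> * \<eta>B\<close>.
\<close>

lemma writhe_R3:
  assumes signs: "{\<delta>, \<eta>T, \<eta>M, \<eta>B} \<subseteq> {1, -1}"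
    "ea = \<delta> * \<eta>T * \<eta>M" "eb = \<delta> * \<eta>M * \<eta>B" "ec = - \<delta> * \<eta>T * \<eta>B"
    and strands: "sT = strand \<eta>T (Over c ec) (Over a ea)"
    "sM = strand \<eta>M (Under a ea) (Over b eb)"
    "sB = strand \<eta>B (Under b eb) (Under c ec)"
    and arcs: "{# P, Q, R #} = {# sT, sM, sB #}"
    and v: "gauss_diagram (P @ X @ Q @ Y @ R @ Z)"
  shows "writhe g (P @ X @ Q @ Y @ R @ Z) = writhe g (rev P @ X @ rev Q @ Y @ rev R @ Z)"
    (is "writhe g ?v = writhe g ?w")
proof (rule writhe_cong[symmetric])
  show "chords ?w = chords ?v"
    by (simp add: chords_def)
  have dist: "distinct ?v" using v by (rule gauss_diagram_distinct)
  note sets = three_arcs[OF arcs]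
  have "distinct (P @ Q @ R)" using dist by auto
  then have ends: "distinct (sT @ sM @ sB)"
    using mset_eq_imp_distinct_iff[OF sets(2)] by blast
  have union: "set P \<union> set Q \<union> set R = set sT \<union> set sM \<union> set sB"
    using mset_eq_setD[OF sets(2)] by auto
  \<comment> \<open>the change of height under the move\<close>
  define h where "h x = height ?w x - height ?v x" for x
  have inside: "h x = height (rev S) x - height S x" if "S \<in> {sT, sM, sB}" "x \<in> set S" for S x
    using height_reverse_arcs[OF dist] that sets(1) unfolding h_def by blast
  have outside: "h x = 0" if "x \<notin> set sT \<union> set sM \<union> set sB" for x
    using height_reverse_arcs_outside[of x P Q R] that union by (simp add: h_def)
  have h: "h (Over c ec) = \<eta>T * ea" "h (Over a ea) = - \<eta>T * ec"
    "h (Under a ea) = \<eta>M * eb" "h (Over b eb) = \<eta>M * ea"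
    "h (Under b eb) = - \<eta>B * ec" "h (Under c ec) = \<eta>B * eb"
    using ends signs(1) inside[of sT] inside[of sM] inside[of sB]
    by (auto simp: strands strand_def)
  fix c' e' assume "(c', e') \<in> chords ?v"
  have "h (Under c' e') = h (Over c' e')"
  proof (cases "(c', e') \<in> {(a, ea), (b, eb), (c, ec)}")
    case True
    moreover have "h (Under a ea) = h (Over a ea)" "h (Under b eb) = h (Over b eb)"
      "h (Under c ec) = h (Over c ec)"
      unfolding h using signs(1) by (auto simp: signs(2-4))
    ultimately show ?thesis by auto
  next
    case False
    then show ?thesis by (simp add: outside strands strand_def)
  qed
  then show "index ?w c' e' = index ?v c' e'"
    by (simp add: index_def h_def)
qed

lemma writhe_reidemeister_move:
  assumes "g 0 = 0" "reidemeister_move v w" "gauss_diagram v" "gauss_diagram w"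
  shows "writhe g v = writhe g w"
  using assms(2,1,3,4)
proof cases
  case (base_point X Y)
  show ?thesis
    using assms(3) unfolding base_point by (rule writhe_base_point)
next
  case (relabel f)
  then show ?thesis by (simp add: writhe_relabel)
next
  case R1
  show ?thesis
    using assms(1,3,4) unfolding R1 by (rule writhe_R1)
next
  case R2
  show ?thesis
    using assms(3,4) unfolding R2 by (rule writhe_R2)
next
  case R3
  show ?thesis
    using assms(3) unfolding R3(1,2) by (rule writhe_R3[OF R3(3-10)])
qed

lemma writhe_reidemeister_step:
  assumes "g 0 = 0" "reidemeister_step v w"
  shows "writhe g v = writhe g w"
  using assms(2) writhe_reidemeister_move[of g v w, OF assms(1)]
    writhe_reidemeister_move[of g w v, OF assms(1)]
  by (auto simp: reidemeister_step_def)

lemma writhe_diagram_equiv: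
  assumes "g 0 = 0" "(v, w) \<in> diagram_equiv"
  shows "writhe g v = writhe g w"
proof -
  have "reidemeister_step\<^sup>*\<^sup>* v w" using assms(2) by (simp add: diagram_equiv_def)
  then show ?thesis
    by induction (auto simp: writhe_reidemeister_step[of g, OF assms(1)])
qed

section \<open>The odd writhe bounds the unknotting number from below\<close>

abbreviation odd_writhe :: "'c endpoint list \<Rightarrow> int" where
  "odd_writhe \<equiv> writhe (\<lambda>n. n mod 2)"

text \<open>
  An arc carries two weights \<open>\<plusminus>1\<close>, so parities of heights outside the arcs do not change.  The two
  endpoints on one arc have heights of different parity.  Adding this up over the three arcs shows
  that the indices of the three deleted chords have an even sum; so one of them is even, and at most
  two of the deleted chords contribute to the odd writhe.
\<close>

lemma odd_writhe_vdelta_move: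
  assumes "vdelta_move v w" "gauss_diagram v" "gauss_diagram w"
  shows "\<bar>odd_writhe v - odd_writhe w\<bar> \<le> 2"
  using assms(1)
proof cases
  case (1 \<delta> \<eta>1 \<eta>2 \<eta>3 e1 e2 e3 s1 c3 c1 s2 c2 s3 P Q R X Y Z)
  note strands = 1(7-9)
  have e: "{e1, e2, e3} \<subseteq> {1, -1}"
    using 1(3) by (auto simp: 1(4-6))
  have dist: "distinct (P @ X @ Q @ Y @ R @ Z)"
    using gauss_diagram_distinct[OF assms(2)] by (simp only: 1(1))
  note sets = three_arcs[OF 1(10)]
  have "distinct (P @ Q @ R)" using dist by auto
  then have ends: "distinct (s1 @ s2 @ s3)"
    using mset_eq_imp_distinct_iff[OF sets(2)] by blast
  have union: "set P \<union> set Q \<union> set R = set s1 \<union> set s2 \<union> set s3"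
    using mset_eq_setD[OF sets(2)] by auto
  have even_arc: "even (total_weight S)" if "S \<in> {s1, s2, s3}" for S
    using that e by (auto simp: strands strand_def)
  then have even_arcs: "even (total_weight P)" "even (total_weight Q)" "even (total_weight R)"
    using sets(1) by blast+
  have parity: "even (height v x - height w x)" if "x \<in> set w" for x
    using that dist even_arcs by (auto simp: 1(1,2) height_append)
  have arc: "height v y = height v x + weight x" if "[x, y] \<in> {s1, s2, s3}" for x y
  proof -
    have "[x, y] \<in> {P, Q, R}" using that sets(1) by simp
    then obtain A B where "v = A @ [x, y] @ B"
      unfolding 1(1) by (metis append.assoc append_Nil empty_iff insert_iff)
    then show ?thesis
      using height_adjacent gauss_diagram_distinct[OF assms(2)] by simp
  qed
  define D where "D = {(c1, e1), (c2, e2), (c3, e3)}"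
  have distinct_chords: "(c1, e1) \<noteq> (c2, e2)" "(c1, e1) \<noteq> (c3, e3)" "(c2, e2) \<noteq> (c3, e3)"
    using ends by (auto simp: strands strand_def split: if_splits)
  have "Over c e \<in> set P \<union> set Q \<union> set R \<longleftrightarrow> Over c e \<in> set s1 \<union> set s2 \<union> set s3" for c e
    by (simp only: union)
  then have "chords v = chords s1 \<union> chords s2 \<union> chords s3 \<union> chords w"
    unfolding 1(1,2) chords_def by auto
  then have "chords v = D \<union> chords w"
    by (auto simp: D_def strands strand_def chords_def split: if_splits)
  moreover have "D \<inter> chords w = {}"
  proof -
    have "(set s1 \<union> set s2 \<union> set s3) \<inter> set w = {}"
      using dist by (auto simp: 1(2) union[symmetric])
    then show ?thesis by (auto simp: D_def strands strand_def chords_def split: if_splits)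
  qed
  moreover have "index v c e mod 2 = index w c e mod 2" if "(c, e) \<in> chords w" for c e
  proof -
    have "index v c e - index w c e = (height v (Under c e) - height w (Under c e))
        - (height v (Over c e) - height w (Over c e))"
      by (simp add: index_def)
    moreover have "even \<dots>"
      by (intro dvd_diff parity chord_endpoints[OF assms(3) that])
    ultimately show ?thesis by (simp only: mod_eq_dvd_iff)
  qed
  ultimately have "odd_writhe v = (\<Sum>(c, e)\<in>D. e * (index v c e mod 2)) + odd_writhe w"
    by (rule writhe_remove_chords)
  moreover have "(\<Sum>(c, e)\<in>D. e * (index v c e mod 2)) =
      e1 * (index v c1 e1 mod 2) + e2 * (index v c2 e2 mod 2) + e3 * (index v c3 e3 mod 2)"
    using distinct_chords by (auto simp: D_def)
  moreover have "even (index v c1 e1 + index v c2 e2 + index v c3 e3)"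
  proof -
    have odd_arc: "odd (height v x + height v y)"
      if "strand \<eta> x y \<in> {s1, s2, s3}" "odd (weight x)" "odd (weight y)" for \<eta> x y
    proof (cases "\<eta> = 1")
      case True
      then have "height v y = height v x + weight x"
        using that(1) by (intro arc) (simp add: strand_def)
      with that(2) show ?thesis by simp
    next
      case False
      then have "height v x = height v y + weight y"
        using that(1) by (intro arc) (simp add: strand_def)
      with that(3) show ?thesis by simp
    qed
    have odd_signs: "odd e1" "odd e2" "odd e3" using e by auto
    then have "odd (height v (Under c3 e3) + height v (Over c1 e1))"
      "odd (height v (Under c1 e1) + height v (Over c2 e2))"
      "odd (height v (Under c2 e2) + height v (Over c3 e3))"
      using odd_arc[of \<eta>1 "Under c3 e3" "Over c1 e1"] odd_arc[of \<eta>2 "Under c1 e1" "Over c2 e2"]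
        odd_arc[of \<eta>3 "Under c2 e2" "Over c3 e3"]
      by (simp_all add: strands)
    with odd_signs show ?thesis by (auto simp: index_def)
  qed
  then have "index v c1 e1 mod 2 = 0 \<or> index v c2 e2 mod 2 = 0 \<or> index v c3 e3 mod 2 = 0"
    by (auto simp flip: even_iff_mod_2_eq_zero)
  then have "e1 * (index v c1 e1 mod 2) = 0 \<or> e2 * (index v c2 e2 mod 2) = 0
      \<or> e3 * (index v c3 e3 mod 2) = 0"
    by (elim disj_forward) simp_all
  moreover have "\<bar>e * (n mod 2)\<bar> \<le> 1" if "e \<in> {1, -1}" for e n :: int
    using that by auto
  then have "\<bar>e1 * (index v c1 e1 mod 2)\<bar> \<le> 1" "\<bar>e2 * (index v c2 e2 mod 2)\<bar> \<le> 1"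
    "\<bar>e3 * (index v c3 e3 mod 2)\<bar> \<le> 1"
    using e by blast+
  ultimately show ?thesis by linarith
qed

lemma odd_writhe_vdelta_sequence:
  assumes "vdelta_sequence n v w"
  shows "\<bar>odd_writhe v - odd_writhe w\<bar> \<le> 2 * int n"
  using assms
proof induction
  case (reidemeister n u v w)
  then show ?case using writhe_reidemeister_step[of "\<lambda>n. n mod 2" v w] by simp
next
  case (vdelta n u v w)
  then have "\<bar>odd_writhe v - odd_writhe w\<bar> \<le> 2"
    using odd_writhe_vdelta_move[of v w] odd_writhe_vdelta_move[of w v]
    by (auto simp: vdelta_step_def)
  with vdelta.IH show ?case by simp
qed simp

section \<open>Realization\<close>

lemma vdelta_sequence_trans:
  assumes "vdelta_sequence n v w" "vdelta_sequence m u v"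
  shows "vdelta_sequence (m + n) u w"
  using assms
  by induction (auto intro: vdelta_sequence.intros)

lemma reidemeister_steps_imp_vdelta_sequence:
  assumes "reidemeister_step\<^sup>*\<^sup>* v w" "gauss_diagram v"
  shows "vdelta_sequence 0 v w"
  using assms by induction (auto intro: vdelta_sequence.intros)

lemma gauss_diagram_rotate:
  assumes "gauss_diagram (v @ w)"
  shows "gauss_diagram (w @ v)"
proof -
  have sets: "set (w @ v) = set (v @ w)" "distinct (w @ v) = distinct (v @ w)"
    by auto
  show ?thesis
    using assms unfolding gauss_diagram_def sets .
qed

text \<open>
  The first Reidemeister move is stated at the base point; moving the base point there and back makes
  it available anywhere in the word.
\<close>

lemma R1_inside:
  assumes "gauss_diagram (X @ [Over c e, Under c e] @ Y)" "gauss_diagram (X @ Y)"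
  shows "reidemeister_step\<^sup>*\<^sup>* (X @ [Over c e, Under c e] @ Y) (X @ Y)"
proof -
  have g: "gauss_diagram ([Over c e, Under c e] @ Y @ X)"
    using gauss_diagram_rotate[OF assms(1)] by simp
  have "reidemeister_step (X @ [Over c e, Under c e] @ Y) ([Over c e, Under c e] @ Y @ X)"
    using assms(1) g base_point[of X "[Over c e, Under c e] @ Y"]
    by (simp add: reidemeister_step_def)
  moreover have "reidemeister_step ([Over c e, Under c e] @ Y @ X) (Y @ X)"
    using g gauss_diagram_rotate[OF assms(2)] R1[of 1 c e "Y @ X"]
    by (simp add: reidemeister_step_def strand_def)
  moreover have "reidemeister_step (Y @ X) (X @ Y)"
    using gauss_diagram_rotate[OF assms(2)] assms(2) base_point by (simp add: reidemeister_step_def)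
  ultimately show ?thesis by (meson converse_rtranclp_into_rtranclp rtranclp.rtrancl_refl)
qed

lemma gauss_diagramD:
  assumes "gauss_diagram w"
  shows "Over c e \<in> set w \<longleftrightarrow> Under c e \<in> set w"
    and "Over c e \<in> set w \<Longrightarrow> Over c e' \<in> set w \<Longrightarrow> e = e'"
    and "Over c e \<in> set w \<Longrightarrow> e \<in> {1, -1}"
  using assms unfolding gauss_diagram_def by blast+

lemma gauss_diagram_relabel:
  assumes "inj f" "gauss_diagram w"
  shows "gauss_diagram (map (map_endpoint f) w)"
  unfolding gauss_diagram_def set_map Over_relabel_iff Under_relabel_iff
proof (intro conjI allI impI)
  have "inj_on (map_endpoint f) (set w)"
    using endpoint.inj_map[OF assms(1)] by (rule inj_on_subset) simp
  then show "distinct (map (map_endpoint f) w)"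
    using gauss_diagram_distinct[OF assms(2)] by (simp add: distinct_map)
next
  fix c e
  show "(\<exists>b. c = f b \<and> Over b e \<in> set w) \<longleftrightarrow> (\<exists>b. c = f b \<and> Under b e \<in> set w)"
    by (simp only: gauss_diagramD(1)[OF assms(2)])
next
  fix c e e'
  assume "(\<exists>b. c = f b \<and> Over b e \<in> set w) \<and> (\<exists>b. c = f b \<and> Over b e' \<in> set w)"
  then obtain b b' where b: "f b = f b'" "Over b e \<in> set w" "Over b' e' \<in> set w" by auto
  from b show "e = e'"
    unfolding injD[OF assms(1) b(1)] by (intro gauss_diagramD(2)[OF assms(2)])
next
  fix c e
  assume "\<exists>b. c = f b \<and> Over b e \<in> set w"
  then show "e \<in> {1, -1}" by (elim exE conjE gauss_diagramD(3)[OF assms(2)])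
qed

lemma gauss_diagram_append:
  assumes "gauss_diagram v" "gauss_diagram w"
    and disjoint: "\<And>c e e'. Over c e \<in> set v \<Longrightarrow> Over c e' \<notin> set w"
  shows "gauss_diagram (v @ w)"
  unfolding gauss_diagram_def set_append Un_iff
proof (intro conjI allI impI)
  have "x \<notin> set w" if "x \<in> set v" for x
  proof (cases x)
    case (Over c e)
    then show ?thesis using that disjoint by simp
  next
    case (Under c e)
    then show ?thesis
      using that disjoint[of c e e]
      by (simp add: gauss_diagramD(1)[OF assms(1)] gauss_diagramD(1)[OF assms(2)])
  qed
  then show "distinct (v @ w)"
    using gauss_diagram_distinct[OF assms(1)] gauss_diagram_distinct[OF assms(2)] by auto
next
  fix c e
  show "Over c e \<in> set v \<or> Over c e \<in> set w \<longleftrightarrow> Under c e \<in> set v \<or> Under c e \<in> set w"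
    by (simp only: gauss_diagramD(1)[OF assms(1)] gauss_diagramD(1)[OF assms(2)])
next
  fix c e e'
  assume "(Over c e \<in> set v \<or> Over c e \<in> set w) \<and> (Over c e' \<in> set v \<or> Over c e' \<in> set w)"
  then show "e = e'"
    using disjoint[of c e e'] disjoint[of c e' e] gauss_diagramD(2)[OF assms(1), of c e e']
      gauss_diagramD(2)[OF assms(2), of c e e'] by blast
next
  fix c e
  assume "Over c e \<in> set v \<or> Over c e \<in> set w"
  then show "e \<in> {1, -1}"
    using gauss_diagramD(3)[OF assms(1)] gauss_diagramD(3)[OF assms(2)] by (elim disjE)
qed

text \<open>
  A connected sum at the base points.  Even names for the first diagram and odd names for the second
  keep the chords apart.
\<close>

definition juxtapose :: "gauss_word \<Rightarrow> gauss_word \<Rightarrow> gauss_word" where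
  "juxtapose v w = map (map_endpoint (\<lambda>c. 2 * c)) v @ map (map_endpoint (\<lambda>c. 2 * c + 1)) w"

lemma inj_juxtapose: "inj (\<lambda>c::nat. 2 * c)" "inj (\<lambda>c::nat. 2 * c + 1)"
  by (auto simp: inj_on_def)

lemma disjoint_juxtapose:
  "map_endpoint (\<lambda>c::nat. 2 * c) ` A \<inter> map_endpoint (\<lambda>c. 2 * c + 1) ` B = {}"
proof -
  have "map_endpoint (\<lambda>c::nat. 2 * c) x \<noteq> map_endpoint (\<lambda>c. 2 * c + 1) y" for x y
    by (cases x; cases y) (simp_all, presburger+)
  then show ?thesis by blast
qed

lemma gauss_diagram_juxtapose:
  assumes "gauss_diagram v" "gauss_diagram w"
  shows "gauss_diagram (juxtapose v w)"
  unfolding juxtapose_def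
proof (rule gauss_diagram_append)
  fix c e e'
  assume "Over c e \<in> set (map (map_endpoint (\<lambda>c. 2 * c)) v)"
  then have "even c" by (auto simp: Over_relabel_iff)
  then show "Over c e' \<notin> set (map (map_endpoint (\<lambda>c. 2 * c + 1)) w)"
    by (auto simp: Over_relabel_iff)
qed (rule gauss_diagram_relabel[OF inj_juxtapose(1) assms(1)]
    gauss_diagram_relabel[OF inj_juxtapose(2) assms(2)])+

lemma writhe_append:
  assumes "gauss_diagram v" "gauss_diagram w" "set v \<inter> set w = {}"
  shows "writhe g (v @ w) = writhe g v + writhe g w"
proof -
  have v: "height (v @ w) x = height v x" if "x \<in> set v" for x
    using that by (simp add: height_append)
  have w: "height (v @ w) x = height w x" if "x \<in> set w" for x
    using that assms total_weight_gauss_diagram[OF assms(1)] by (auto simp: height_append)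
  have "chords v \<inter> chords w = {}" using assms(3) by (auto simp: chords_def)
  then have "writhe g (v @ w) =
      (\<Sum>(c, e)\<in>chords v. e * g (index (v @ w) c e)) + writhe g w"
    using index_eqI[OF assms(2) w] by (intro writhe_remove_chords) auto
  also have "(\<Sum>(c, e)\<in>chords v. e * g (index (v @ w) c e)) = writhe g v"
    unfolding writhe_def using index_eqI[OF assms(1) v] by (auto intro!: sum.cong)
  finally show ?thesis .
qed

lemma writhe_juxtapose:
  assumes "gauss_diagram v" "gauss_diagram w"
  shows "writhe g (juxtapose v w) = writhe g v + writhe g w"
  using writhe_append[OF gauss_diagram_relabel[OF inj_juxtapose(1) assms(1)]
      gauss_diagram_relabel[OF inj_juxtapose(2) assms(2)]] disjoint_juxtapose[of "set v" "set w"]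
  by (simp only: juxtapose_def set_map writhe_relabel[OF inj_juxtapose(1)]
      writhe_relabel[OF inj_juxtapose(2)])

text \<open>
  \<open>overs n @ unders n\<close> consists of \<open>n\<close> nested positive chords, with the chord of largest name
  innermost.  The names start at 3 to leave 0, 1, 2 for the chords of a virtualized Delta-move.
\<close>

primrec overs :: "nat \<Rightarrow> gauss_word" where
  "overs 0 = []"
| "overs (Suc n) = overs n @ [Over (n + 3) 1]"

primrec unders :: "nat \<Rightarrow> gauss_word" where
  "unders 0 = []"
| "unders (Suc n) = Under (n + 3) 1 # unders n"

text \<open>
  The chords 0, 1, 2 are those of a virtualized Delta-move with \<open>\<delta> = -1\<close>, \<open>\<eta>1 = -1\<close> and
  \<open>\<eta>2 = \<eta>3 = 1\<close>; hence their signs are \<open>1, -1, 1\<close>.  Each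
  nested chord has the second arc between its endpoints.
\<close>

definition triangle_diagram :: "nat \<Rightarrow> gauss_word" where
  "triangle_diagram n = [Over 0 1, Under 2 1] @ overs n @ [Under 0 1, Over 1 (-1)] @ unders n
     @ [Under 1 (-1), Over 2 1]"

lemma set_overs: "set (overs n) = (\<lambda>i. Over (i + 3) 1) ` {..<n}"
  by (induction n) (auto simp: lessThan_Suc)

lemma set_unders: "set (unders n) = (\<lambda>i. Under (i + 3) 1) ` {..<n}"
  by (induction n) (auto simp: lessThan_Suc)

lemma distinct_overs: "distinct (overs n)"
  by (induction n) (auto simp: set_overs)

lemma distinct_unders: "distinct (unders n)"
  by (induction n) (auto simp: set_unders)

lemma gauss_diagram_nested: "gauss_diagram (overs n @ unders n)"
  by (auto simp: gauss_diagram_def distinct_overs distinct_unders set_overs set_unders)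

lemma gauss_diagram_triangle_diagram: "gauss_diagram (triangle_diagram n)"
  by (auto simp: gauss_diagram_def triangle_diagram_def distinct_overs distinct_unders
      set_overs set_unders)

lemma total_weight_overs: "total_weight (overs n) = int n"
  by (induction n) auto

lemma total_weight_unders: "total_weight (unders n) = - int n"
  by (induction n) auto

lemma height_overs: "i < n \<Longrightarrow> height (overs n) (Over (i + 3) 1) = int i"
  by (induction n) (auto simp: height_append set_overs total_weight_overs less_Suc_eq)

lemma height_unders: "i < n \<Longrightarrow> height (unders n) (Under (i + 3) 1) = int i + 1 - int n"
  by (induction n) (auto simp: less_Suc_eq)

text \<open>
  The chords 0, 1, 2 have the indices \<open>n - 1\<close>, \<open>-n\<close>, \<open>1\<close>.  Along a nested chord, the chords further
  inside cancel, so that only the second arc, of weight \<open>-2\<close>, contributes to its index.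
\<close>

lemma writhe_triangle_diagram:
  "writhe g (triangle_diagram n) = g (int n - 1) - g (- int n) + g 1 + int n * g (-2)"
proof -
  let ?N = "(\<lambda>i. (i + 3, 1)) ` {..<n}"
  have chords: "chords (triangle_diagram n) = {(0, 1), (1, -1), (2, 1)} \<union> ?N"
    by (auto simp: chords_def triangle_diagram_def set_overs set_unders)
  have index: "index (triangle_diagram n) 0 1 = int n - 1" "index (triangle_diagram n) 1 (-1) = - int n"
    "index (triangle_diagram n) 2 1 = 1" "\<And>i. i < n \<Longrightarrow> index (triangle_diagram n) (i + 3) 1 = -2"
    by (auto simp: index_def triangle_diagram_def height_append set_overs set_unders total_weight_overs
        total_weight_unders height_overs height_unders)
  have "writhe g (triangle_diagram n) =
      (\<Sum>(c, e)\<in>{(0, 1), (1, -1), (2, 1)}. e * g (index (triangle_diagram n) c e))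
      + (\<Sum>(c, e)\<in>?N. e * g (index (triangle_diagram n) c e))"
    unfolding writhe_def chords by (rule sum.union_disjoint) auto
  also have "(\<Sum>(c, e)\<in>?N. e * g (index (triangle_diagram n) c e)) = (\<Sum>i<n. g (-2))"
    by (subst sum.reindex) (auto simp: inj_on_def index simp del: One_nat_def intro!: sum.cong)
  finally show ?thesis by (simp add: index del: One_nat_def)
qed

definition triangle_sum :: "nat \<Rightarrow> nat \<Rightarrow> gauss_word" where
  "triangle_sum n m = (juxtapose (triangle_diagram n) ^^ m) []"

lemma triangle_sum_simps:
  "triangle_sum n 0 = []"
  "triangle_sum n (Suc m) = juxtapose (triangle_diagram n) (triangle_sum n m)"
  by (simp_all add: triangle_sum_def)

lemma gauss_diagram_Nil: "gauss_diagram []"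
  by (simp add: gauss_diagram_def)

lemma gauss_diagram_triangle_sum: "gauss_diagram (triangle_sum n m)"
  by (induction m)
    (simp_all add: triangle_sum_simps gauss_diagram_Nil gauss_diagram_juxtapose
      gauss_diagram_triangle_diagram)

lemma writhe_triangle_sum: "writhe g (triangle_sum n m) = int m * writhe g (triangle_diagram n)"
proof (induction m)
  case 0
  show ?case by (simp add: triangle_sum_simps writhe_def chords_def)
next
  case (Suc m)
  then show ?case
    by (simp add: triangle_sum_simps writhe_juxtapose gauss_diagram_triangle_diagram
        gauss_diagram_triangle_sum
        algebra_simps)
qed

text \<open>
  The innermost chord is isolated, so a first Reidemeister move deletes it and exposes the next one.
\<close>

lemma remove_nested_chords:
  assumes "gauss_diagram w"
  shows "reidemeister_step\<^sup>*\<^sup>* (juxtapose (overs n @ unders n) w) (juxtapose [] w)"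
proof (induction n)
  case (Suc n)
  let ?f = "map (map_endpoint (\<lambda>c. 2 * c))"
  have "reidemeister_step\<^sup>*\<^sup>* (juxtapose (overs (Suc n) @ unders (Suc n)) w)
      (juxtapose (overs n @ unders n) w)"
    using R1_inside[of "?f (overs n)" "2 * (n + 3)" 1
        "?f (unders n) @ map (map_endpoint (\<lambda>c. 2 * c + 1)) w"]
      gauss_diagram_juxtapose[OF gauss_diagram_nested[of "Suc n"] assms]
      gauss_diagram_juxtapose[OF gauss_diagram_nested[of n] assms]
    by (simp add: juxtapose_def)
  with Suc.IH show ?case by simp
qed (simp add: juxtapose_def)

lemma vdelta_triangle_diagram:
  "vdelta_move (juxtapose (triangle_diagram n) w) (juxtapose (overs n @ unders n) w)"
proof -
  let ?f = "map (map_endpoint (\<lambda>c::nat. 2 * c))" and ?g = "map (map_endpoint (\<lambda>c::nat. 2 * c + 1))"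
  have "vdelta_move
     ([Over 0 1, Under 4 1] @ ?f (overs n) @ [Under 0 1, Over 2 (-1)] @ ?f (unders n)
        @ [Under 2 (-1), Over 4 1] @ ?g w)
     (?f (overs n) @ ?f (unders n) @ ?g w)"
    by (rule vdelta_move.intros[where \<delta> = "-1" and ?\<eta>1.0 = "-1" and ?\<eta>2.0 = 1 and ?\<eta>3.0 = 1
          and ?c1.0 = 0 and ?c2.0 = 2 and ?c3.0 = 4,
          OF _ refl refl refl refl refl refl]) (simp_all add: strand_def)
  then show ?thesis by (simp add: juxtapose_def triangle_diagram_def)
qed

text \<open>
  One virtualized Delta-move per copy: it deletes the three chords of the first copy, after which
  Reidemeister moves remove what is left of that copy and restore the chord names of the others.
\<close>

lemma vdelta_sequence_triangle_sum: "vdelta_sequence m (triangle_sum n m) []"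
proof (induction m)
  case 0
  show ?case by (simp add: triangle_sum_simps gauss_diagram_Nil start)
next
  case (Suc m)
  let ?w = "triangle_sum n m"
  note g = gauss_diagram_triangle_sum[of n m]
  have nested: "gauss_diagram (juxtapose (overs n @ unders n) ?w)"
    by (intro gauss_diagram_juxtapose gauss_diagram_nested g)
  have "vdelta_step (juxtapose (triangle_diagram n) ?w) (juxtapose (overs n @ unders n) ?w)"
    using vdelta_triangle_diagram nested gauss_diagram_juxtapose[OF gauss_diagram_triangle_diagram g]
    by (simp add: vdelta_step_def)
  then have one: "vdelta_sequence (Suc 0) (juxtapose (triangle_diagram n) ?w)
      (juxtapose (overs n @ unders n) ?w)"
    by (auto intro: vdelta_sequence.intros simp: vdelta_step_def)
  have "reidemeister_step (juxtapose [] ?w) ?w"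
    using g gauss_diagram_juxtapose[OF gauss_diagram_Nil g] relabel[OF inj_juxtapose(2), of ?w]
    by (simp add: reidemeister_step_def juxtapose_def)
  with remove_nested_chords[OF g, of n]
  have "vdelta_sequence 0 (juxtapose (overs n @ unders n) ?w) ?w"
    using nested by (intro reidemeister_steps_imp_vdelta_sequence) auto
  from vdelta_sequence_trans[OF Suc.IH vdelta_sequence_trans[OF this one]] show ?case
    by (simp add: triangle_sum_simps)
qed

theorem theorem1p4:
  fixes m :: nat
  assumes "m \<ge> 1"
  shows "infinite {K \<in> virtual_knots. vdelta_unknotting_number K = enat m}"
proof -
  \<comment> \<open>The odd writhe of the summand is 2 only for an even number of nested chords.\<close>
  define K where "K k = diagram_equiv `` {triangle_sum (2 * k) m}" for k
  have refl: "(w, w) \<in> diagram_equiv" if "gauss_diagram w" for w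
    using that by (simp add: diagram_equiv_def)
  have knots: "K k \<in> virtual_knots" for k
    by (auto simp: K_def virtual_knots_def intro: quotientI gauss_diagram_triangle_sum)
  have number: "vdelta_unknotting_number (K k) = enat m" for k
  proof (rule antisym)
    have "triangle_sum (2 * k) m \<in> K k" "[] \<in> trivial_knot"
      by (auto simp: K_def trivial_knot_def refl gauss_diagram_triangle_sum gauss_diagram_Nil)
    then show "vdelta_unknotting_number (K k) \<le> enat m"
      unfolding vdelta_unknotting_number_def using vdelta_sequence_triangle_sum
      by (blast intro: Inf_lower)
    have "m \<le> n" if "v \<in> K k" "w \<in> trivial_knot" "vdelta_sequence n v w" for n v w
    proof -
      have minus_one_mod: "(2 * int k - 1) mod 2 = 1" by presburger
      have "odd_writhe v = odd_writhe (triangle_sum (2 * k) m)"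
        using that(1) writhe_diagram_equiv[of "\<lambda>n. n mod 2"] by (simp add: K_def)
      also have "\<dots> = 2 * int m"
        using minus_one_mod by (simp add: writhe_triangle_sum writhe_triangle_diagram)
      finally have "odd_writhe v = 2 * int m" .
      moreover have "odd_writhe w = 0"
        using that(2) writhe_diagram_equiv[of "\<lambda>n. n mod 2" "[]" w]
        by (simp add: trivial_knot_def writhe_def chords_def)
      ultimately show ?thesis using odd_writhe_vdelta_sequence[OF that(3)] by simp
    qed
    then show "enat m \<le> vdelta_unknotting_number (K k)"
      unfolding vdelta_unknotting_number_def by (intro Inf_greatest) auto
  qed
  have "inj K"
  proof (rule injI)
    fix k l assume "K k = K l"
    then have "(triangle_sum (2 * k) m, triangle_sum (2 * l) m) \<in> diagram_equiv"
      unfolding K_def using refl gauss_diagram_triangle_sum by blast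
    then have "writhe (\<lambda>n. n\<^sup>2) (triangle_sum (2 * k) m) = writhe (\<lambda>n. n\<^sup>2) (triangle_sum (2 * l) m)"
      by (intro writhe_diagram_equiv) simp_all
    moreover have "writhe (\<lambda>n. n\<^sup>2) (triangle_sum (2 * k) m) = int m * (4 * int k + 2)" for k
      by (simp add: writhe_triangle_sum writhe_triangle_diagram power2_eq_square algebra_simps)
    ultimately show "k = l" using assms by simp
  qed
  then have "infinite (range K)" by (rule range_inj_infinite)
  moreover have "range K \<subseteq> {K \<in> virtual_knots. vdelta_unknotting_number K = enat m}"
    using knots number by auto
  ultimately show ?thesis by (rule infinite_super[rotated])
qed

end
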